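(* Let $SB_3$ be the singular braid group on $3$ strands, let $ST_3$ be the kernel of the homomorphism $\pi: SB_3\to S_3$ given by $\pi(\sigma_i)=(i,i+1)$, $\pi(\tau_i)=1$ for $i=1,2$, and let $SP_3$ (the singular pure braid group on $3$ strands) be the kernel of the homomorphism $SB_3\to S_3$ that sends both $\sigma_i$ and $\tau_i$ to $(i,i+1)$ for $i=1,2$. Then the group $ST_3$ is isomorphic to the group $SP_3$.
   Context: The singular braid group $SB_3$ is the group generated by $\sigma_1,\sigma_2,\tau_1,\tau_2$ with defining relations $$\sigma_1\sigma_2\sigma_1=\sigma_2\sigma_1\sigma_2,\quad \sigma_1\tau_1=\tau_1\sigma_1,\quad \sigma_2\tau_2=\tau_2\sigma_2,\quad \sigma_1\sigma_2\tau_1=\tau_2\sigma_1\sigma_2,\quad \sigma_2\sigma_1\tau_2=\tau_1\sigma_2\sigma_1.$$ $S_3$ is the symmetric group on $3$ symbols and $(i,i+1)$ denotes the transposition. *)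

theory Defs
  imports "HOL-Algebra.Algebra" "HOL-Combinatorics.Combinatorics"
begin

section \<open>Groups given by generators and relations\<close>

text \<open>
  A word over the alphabet \<open>'a\<close> and its formal inverses: the letter \<open>(True, x)\<close> stands for
  the generator \<open>x\<close> and \<open>(False, x)\<close> for its inverse.
\<close>

type_synonym 'a gword = "(bool \<times> 'a) list"

text \<open>
  The presented group has all elements of the type \<open>'a\<close> as its generators; a pair \<open>(l, r)\<close>
  in \<open>R\<close> is the defining relation \<open>l = r\<close>. It is built as the quotient of the monoid of words
  by the congruence generated by free cancellation and \<open>R\<close>.
\<close>

inductive pres_eq :: "('a gword \<times> 'a gword) set \<Rightarrow> 'a gword \<Rightarrow> 'a gword \<Rightarrow> bool"
  for R where
  refl: "pres_eq R w w"
| sym: "pres_eq R u v \<Longrightarrow> pres_eq R v u"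
| trans: "pres_eq R u v \<Longrightarrow> pres_eq R v w \<Longrightarrow> pres_eq R u w"
| cancel: "pres_eq R (u @ [(b, x), (\<not> b, x)] @ v) (u @ v)"
| rel: "(l, r) \<in> R \<Longrightarrow> pres_eq R (u @ l @ v) (u @ r @ v)"

definition pres_class :: "('a gword \<times> 'a gword) set \<Rightarrow> 'a gword \<Rightarrow> 'a gword set" where
  "pres_class R w = {w'. pres_eq R w w'}"

definition presented_group :: "('a gword \<times> 'a gword) set \<Rightarrow> 'a gword set monoid" where
  "presented_group R =
    \<lparr> carrier = range (pres_class R),
      monoid.mult = (\<lambda>A B. \<Union>u\<in>A. \<Union>v\<in>B. pres_class R (u @ v)),
      one = pres_class R [] \<rparr>"

definition pres_gen :: "('a gword \<times> 'a gword) set \<Rightarrow> 'a \<Rightarrow> 'a gword set" where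
  "pres_gen R x = pres_class R [(True, x)]"

lemma pres_eq_append_left: "pres_eq R u v \<Longrightarrow> pres_eq R (w @ u) (w @ v)"
proof (induction rule: pres_eq.induct)
  case (cancel u b x v)
  show ?case using pres_eq.cancel[of R "w @ u" b x v] by simp
next
  case (rel l r u v)
  then show ?case using pres_eq.rel[of l r R "w @ u" v] by simp
qed (simp add: pres_eq.refl, erule pres_eq.sym, erule (1) pres_eq.trans)

lemma pres_eq_append_right: "pres_eq R u v \<Longrightarrow> pres_eq R (u @ w) (v @ w)"
proof (induction rule: pres_eq.induct)
  case (cancel u b x v)
  show ?case using pres_eq.cancel[of R u b x "v @ w"] by simp
next
  case (rel l r u v)
  then show ?case using pres_eq.rel[of l r R u "v @ w"] by simp
qed (simp add: pres_eq.refl, erule pres_eq.sym, erule (1) pres_eq.trans)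

lemma pres_eq_append:
  "pres_eq R u u' \<Longrightarrow> pres_eq R v v' \<Longrightarrow> pres_eq R (u @ v) (u' @ v')"
  by (meson pres_eq.trans pres_eq_append_left pres_eq_append_right)

lemma pres_class_eq_iff: "pres_class R u = pres_class R v \<longleftrightarrow> pres_eq R u v"
proof
  assume "pres_class R u = pres_class R v"
  moreover have "v \<in> pres_class R v" by (simp add: pres_class_def pres_eq.refl)
  ultimately show "pres_eq R u v" by (simp add: pres_class_def set_eq_iff)
next
  assume uv: "pres_eq R u v"
  have "pres_eq R u w \<longleftrightarrow> pres_eq R v w" for w
    using pres_eq.trans[OF uv] pres_eq.trans[OF pres_eq.sym[OF uv]] by blast
  then show "pres_class R u = pres_class R v" by (simp add: pres_class_def)
qed

lemma mem_pres_class_iff: "v \<in> pres_class R u \<longleftrightarrow> pres_eq R u v"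
  by (simp add: pres_class_def)

lemma carrier_presented_group: "carrier (presented_group R) = range (pres_class R)"
  by (simp add: presented_group_def)

lemma one_presented_group: "\<one>\<^bsub>presented_group R\<^esub> = pres_class R []"
  by (simp add: presented_group_def)

lemma mult_presented_group:
  "pres_class R u \<otimes>\<^bsub>presented_group R\<^esub> pres_class R v = pres_class R (u @ v)"
proof -
  have *: "pres_class R (u' @ v') = pres_class R (u @ v)"
    if "u' \<in> pres_class R u" "v' \<in> pres_class R v" for u' v'
    using that by (simp add: pres_class_eq_iff mem_pres_class_iff pres_eq.sym pres_eq_append)
  have "u \<in> pres_class R u" "v \<in> pres_class R v"
    by (simp_all add: mem_pres_class_iff pres_eq.refl)
  then have "(\<Union>u'\<in>pres_class R u. \<Union>v'\<in>pres_class R v. pres_class R (u' @ v'))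
      = pres_class R (u @ v)"
    using * by blast
  then show ?thesis
    by (simp add: presented_group_def)
qed

definition word_inv :: "'a gword \<Rightarrow> 'a gword" where
  "word_inv w = rev (map (\<lambda>(b, x). (\<not> b, x)) w)"

lemma pres_eq_word_inv_left: "pres_eq R (word_inv w @ w) []"
proof (induction w)
  case Nil
  show ?case by (simp add: word_inv_def pres_eq.refl)
next
  case (Cons a w)
  obtain b x where a: "a = (b, x)" by (cases a)
  have "pres_eq R (word_inv w @ [(\<not> b, x), (\<not> \<not> b, x)] @ w) (word_inv w @ w)"
    by (rule pres_eq.cancel)
  then have "pres_eq R (word_inv (a # w) @ a # w) (word_inv w @ w)"
    by (simp add: a word_inv_def)
  then show ?case using Cons.IH pres_eq.trans by blast
qed

lemma group_presented_group: "group (presented_group R)"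
proof (rule groupI)
  fix A assume "A \<in> carrier (presented_group R)"
  then obtain w where "A = pres_class R w" by (auto simp: carrier_presented_group)
  then have "pres_class R (word_inv w) \<otimes>\<^bsub>presented_group R\<^esub> A = \<one>\<^bsub>presented_group R\<^esub>"
    by (simp add: mult_presented_group one_presented_group pres_class_eq_iff
        pres_eq_word_inv_left)
  then show "\<exists>B\<in>carrier (presented_group R). B \<otimes>\<^bsub>presented_group R\<^esub> A = \<one>\<^bsub>presented_group R\<^esub>"
    by (auto simp: carrier_presented_group)
qed (auto simp: carrier_presented_group mult_presented_group one_presented_group)

text \<open>The universal property of the presented group.\<close>

definition letter_eval :: "('g, 'm) monoid_scheme \<Rightarrow> ('a \<Rightarrow> 'g) \<Rightarrow> bool \<times> 'a \<Rightarrow> 'g" where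
  "letter_eval G f l = (if fst l then f (snd l) else inv\<^bsub>G\<^esub> (f (snd l)))"

definition word_eval :: "('g, 'm) monoid_scheme \<Rightarrow> ('a \<Rightarrow> 'g) \<Rightarrow> 'a gword \<Rightarrow> 'g" where
  "word_eval G f w = foldr (\<lambda>l g. letter_eval G f l \<otimes>\<^bsub>G\<^esub> g) w \<one>\<^bsub>G\<^esub>"

context group
begin

lemma letter_eval_closed: "range f \<subseteq> carrier G \<Longrightarrow> letter_eval G f l \<in> carrier G"
  by (auto simp: letter_eval_def)

lemma word_eval_closed: "range f \<subseteq> carrier G \<Longrightarrow> word_eval G f w \<in> carrier G"
  by (induction w) (auto simp: word_eval_def letter_eval_closed)

lemma word_eval_append:
  assumes "range f \<subseteq> carrier G"
  shows "word_eval G f (u @ v) = word_eval G f u \<otimes> word_eval G f v"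
proof (induction u)
  case Nil
  show ?case using word_eval_closed[OF assms] by (simp add: word_eval_def)
next
  case (Cons a u)
  have "word_eval G f ((a # u) @ v) = letter_eval G f a \<otimes> (word_eval G f u \<otimes> word_eval G f v)"
    using Cons.IH by (simp add: word_eval_def)
  also have "\<dots> = (letter_eval G f a \<otimes> word_eval G f u) \<otimes> word_eval G f v"
    using letter_eval_closed[OF assms] word_eval_closed[OF assms] by (simp add: m_assoc)
  finally show ?case by (simp add: word_eval_def)
qed

lemma word_eval_pres_eq:
  assumes "pres_eq R u v" and f: "range f \<subseteq> carrier G"
    and R: "\<And>l r. (l, r) \<in> R \<Longrightarrow> word_eval G f l = word_eval G f r"
  shows "word_eval G f u = word_eval G f v"
  using assms(1)
proof (induction rule: pres_eq.induct)
  case (cancel u b x v)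
  have "f x \<in> carrier G" using f by blast
  then have "word_eval G f [(b, x), (\<not> b, x)] = \<one>"
    by (cases b) (simp_all add: word_eval_def letter_eval_def)
  then show ?case
    using word_eval_closed[OF f] by (simp only: word_eval_append[OF f]) simp
next
  case (rel l r u v)
  then show ?case using R by (simp only: word_eval_append[OF f])
qed simp_all

end

theorem presented_group_universal:
  assumes "group G" and f: "range f \<subseteq> carrier G"
    and R: "\<And>l r. (l, r) \<in> R \<Longrightarrow> word_eval G f l = word_eval G f r"
  shows "\<exists>h\<in>hom (presented_group R) G. \<forall>x. h (pres_gen R x) = f x"
proof
  interpret group G by fact
  define h where "h A = word_eval G f (SOME w. w \<in> A)" for A
  have h: "h (pres_class R w) = word_eval G f w" for w
  proof -
    have "(SOME v. v \<in> pres_class R w) \<in> pres_class R w"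
      by (rule someI[of _ w]) (simp add: mem_pres_class_iff pres_eq.refl)
    then show ?thesis
      unfolding h_def mem_pres_class_iff by (rule word_eval_pres_eq[OF _ f R, symmetric])
  qed
  show "h \<in> hom (presented_group R) G"
    by (auto simp: hom_def carrier_presented_group mult_presented_group h
        word_eval_closed[OF f] word_eval_append[OF f])
  show "\<forall>x. h (pres_gen R x) = f x"
    using f by (simp add: pres_gen_def h word_eval_def letter_eval_def range_subsetD)
qed

theorem presented_group_hom_unique:
  assumes "group G" and h: "h \<in> hom (presented_group R) G" "k \<in> hom (presented_group R) G"
    and eq: "\<And>x. h (pres_gen R x) = k (pres_gen R x)"
    and A: "A \<in> carrier (presented_group R)"
  shows "h A = k A"
proof -
  interpret P: group "presented_group R" by (rule group_presented_group)
  interpret H: group_hom "presented_group R" G h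
    using assms by (simp add: group_hom_def group_hom_axioms_def P.is_group)
  interpret K: group_hom "presented_group R" G k
    using assms by (simp add: group_hom_def group_hom_axioms_def P.is_group)
  have carr: "pres_class R w \<in> carrier (presented_group R)" for w
    by (simp add: carrier_presented_group)
  have inverse: "pres_class R [(False, x)] = inv\<^bsub>presented_group R\<^esub> pres_gen R x" for x
  proof (rule P.inv_equality[symmetric])
    show "pres_class R [(False, x)] \<otimes>\<^bsub>presented_group R\<^esub> pres_gen R x = \<one>\<^bsub>presented_group R\<^esub>"
      using pres_eq.cancel[of R "[]" False x "[]"]
      by (simp add: pres_gen_def mult_presented_group one_presented_group pres_class_eq_iff)
  qed (simp_all add: carr pres_gen_def)
  have letter: "h (pres_class R [a]) = k (pres_class R [a])" for a
  proof (cases a)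
    case (Pair b x)
    have "pres_gen R x \<in> carrier (presented_group R)" by (simp add: pres_gen_def carr)
    then show ?thesis
      using eq[of x] by (cases b) (simp_all add: Pair inverse flip: pres_gen_def)
  qed
  have "h (pres_class R w) = k (pres_class R w)" for w
  proof (induction w)
    case Nil
    show ?case using H.hom_one K.hom_one by (simp add: one_presented_group)
  next
    case (Cons a w)
    have "pres_class R (a # w) = pres_class R [a] \<otimes>\<^bsub>presented_group R\<^esub> pres_class R w"
      by (simp add: mult_presented_group)
    then show ?case using Cons.IH letter[of a] carr by simp
  qed
  then show ?thesis using A by (auto simp: carrier_presented_group)
qed

section \<open>The singular braid group on three strands\<close>

datatype sb3_gen = Sigma1 | Sigma2 | Tau1 | Tau2

abbreviation pos_word :: "'a list \<Rightarrow> 'a gword" where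
  "pos_word xs \<equiv> map (Pair True) xs"

definition SB3_rels :: "(sb3_gen gword \<times> sb3_gen gword) set" where
  "SB3_rels =
    {(pos_word [Sigma1, Sigma2, Sigma1], pos_word [Sigma2, Sigma1, Sigma2]),
     (pos_word [Sigma1, Tau1], pos_word [Tau1, Sigma1]),
     (pos_word [Sigma2, Tau2], pos_word [Tau2, Sigma2]),
     (pos_word [Sigma1, Sigma2, Tau1], pos_word [Tau2, Sigma1, Sigma2]),
     (pos_word [Sigma2, Sigma1, Tau2], pos_word [Tau1, Sigma2, Sigma1])}"

definition SB3 :: "sb3_gen gword set monoid" where
  "SB3 = presented_group SB3_rels"

definition sb3 :: "sb3_gen \<Rightarrow> sb3_gen gword set" where
  "sb3 = pres_gen SB3_rels"

text \<open>
  The homomorphisms to the symmetric group that are used to define the two subgroups exist,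
  and by \<open>presented_group_hom_unique\<close> each is determined by its values on the generators.
\<close>

lemma transpose_in_sym_group3:
  "transpose 1 (2::nat) \<in> carrier (sym_group 3)" "transpose 2 (3::nat) \<in> carrier (sym_group 3)"
  by (auto simp: sym_group_carrier intro!: permutes_swap_id)

lemma transpose_braid:
  "transpose 1 2 \<circ> (transpose 2 3 \<circ> transpose 1 (2::nat))
    = transpose 2 3 \<circ> (transpose 1 2 \<circ> transpose 2 (3::nat))"
  by (rule ext) (simp add: transpose_def)

lemma ST3_hom_exists:
  "\<exists>h\<in>hom SB3 (sym_group 3).
    h (sb3 Sigma1) = transpose 1 2 \<and> h (sb3 Sigma2) = transpose 2 3 \<and>
    h (sb3 Tau1) = \<one>\<^bsub>sym_group 3\<^esub> \<and> h (sb3 Tau2) = \<one>\<^bsub>sym_group 3\<^esub>"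
proof -
  define f :: "sb3_gen \<Rightarrow> nat \<Rightarrow> nat" where
    "f = case_sb3_gen (transpose 1 2) (transpose 2 3) id id"
  have "f x \<in> carrier (sym_group 3)" for x
    using transpose_in_sym_group3 by (cases x) (simp_all add: f_def sym_group_carrier permutes_id)
  moreover have "word_eval (sym_group 3) f l = word_eval (sym_group 3) f r"
    if "(l, r) \<in> SB3_rels" for l r
    using that transpose_braid
    by (auto simp: SB3_rels_def word_eval_def letter_eval_def f_def sym_group_mult sym_group_one)
  ultimately obtain h where "h \<in> hom SB3 (sym_group 3)" "\<And>x. h (sb3 x) = f x"
    using presented_group_universal[OF sym_group_is_group, of f 3 SB3_rels]
    by (auto simp: SB3_def sb3_def)
  then show ?thesis by (intro bexI[of _ h]) (simp_all add: f_def sym_group_one)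
qed

lemma SP3_hom_exists:
  "\<exists>h\<in>hom SB3 (sym_group 3).
    h (sb3 Sigma1) = transpose 1 2 \<and> h (sb3 Sigma2) = transpose 2 3 \<and>
    h (sb3 Tau1) = transpose 1 2 \<and> h (sb3 Tau2) = transpose 2 3"
proof -
  define f :: "sb3_gen \<Rightarrow> nat \<Rightarrow> nat" where
    "f = case_sb3_gen (transpose 1 2) (transpose 2 3) (transpose 1 2) (transpose 2 3)"
  have "f x \<in> carrier (sym_group 3)" for x
    using transpose_in_sym_group3 by (cases x) (simp_all add: f_def)
  moreover have "word_eval (sym_group 3) f l = word_eval (sym_group 3) f r"
    if "(l, r) \<in> SB3_rels" for l r
    using that transpose_braid
    by (auto simp: SB3_rels_def word_eval_def letter_eval_def f_def sym_group_mult sym_group_one)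
  ultimately obtain h where "h \<in> hom SB3 (sym_group 3)" "\<And>x. h (sb3 x) = f x"
    using presented_group_universal[OF sym_group_is_group, of f 3 SB3_rels]
    by (auto simp: SB3_def sb3_def)
  then show ?thesis by (intro bexI[of _ h]) (simp_all add: f_def)
qed

end

theory Submission
  imports Defs
begin

text \<open>
  Multiplying \<open>\<tau>\<^sub>i\<close> on the right by \<open>\<sigma>\<^sub>i\<close> and fixing \<open>\<sigma>\<^sub>1\<close>, \<open>\<sigma>\<^sub>2\<close> preserves the defining relations, and
  so does multiplying by \<open>\<sigma>\<^sub>i\<^sup>-\<^sup>1\<close>. This gives an automorphism \<open>\<phi>\<close> of \<open>SB\<^sub>3\<close>. Since transpositions
  are involutions, \<open>\<rho> \<circ> \<phi> = \<pi>\<close>, so \<open>\<phi>\<close> carries the kernel of \<open>\<pi>\<close> onto that of \<open>\<rho>\<close>.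
\<close>

text \<open>The defining relations of \<open>SB3\<close> as a condition on any group, so that for
  fixed \<open>a\<close>, \<open>b\<close> the pairs \<open>(s, t)\<close> satisfying them can be
  combined. Products are bracketed to the right, the normal form under
  \<open>m_assoc\<close>.\<close>

definition sb3_relations :: "('g, 'm) monoid_scheme \<Rightarrow> 'g \<Rightarrow> 'g \<Rightarrow> 'g \<Rightarrow> 'g \<Rightarrow> bool" where
  "sb3_relations G a b s t \<longleftrightarrow>
    a \<otimes>\<^bsub>G\<^esub> (b \<otimes>\<^bsub>G\<^esub> a) = b \<otimes>\<^bsub>G\<^esub> (a \<otimes>\<^bsub>G\<^esub> b) \<and>
    a \<otimes>\<^bsub>G\<^esub> s = s \<otimes>\<^bsub>G\<^esub> a \<and>
    b \<otimes>\<^bsub>G\<^esub> t = t \<otimes>\<^bsub>G\<^esub> b \<and>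
    a \<otimes>\<^bsub>G\<^esub> (b \<otimes>\<^bsub>G\<^esub> s) = t \<otimes>\<^bsub>G\<^esub> (a \<otimes>\<^bsub>G\<^esub> b) \<and>
    b \<otimes>\<^bsub>G\<^esub> (a \<otimes>\<^bsub>G\<^esub> t) = s \<otimes>\<^bsub>G\<^esub> (b \<otimes>\<^bsub>G\<^esub> a)"

context group
begin

text \<open>The hypothesis says that conjugation by \<open>g\<close> takes \<open>x\<close> to
  \<open>y\<close>, and conjugation respects inverses.\<close>

lemma conj_eq_inv:
  assumes "x \<in> carrier G" "y \<in> carrier G" "g \<in> carrier G" "g \<otimes> x = y \<otimes> g"
  shows "g \<otimes> inv x = inv y \<otimes> g"
  using assms by (metis inv_closed inv_solve_left inv_solve_right m_assoc m_closed)

text \<open>The braid relation says that \<open>a \<otimes> b\<close> conjugates \<open>a\<close> to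
  \<open>b\<close> and that \<open>b \<otimes> a\<close> conjugates \<open>b\<close> to
  \<open>a\<close>; inverting both gives the last two relations.\<close>

lemma sb3_relations_inv:
  assumes "a \<in> carrier G" "b \<in> carrier G" "a \<otimes> (b \<otimes> a) = b \<otimes> (a \<otimes> b)"
  shows "sb3_relations G a b (inv a) (inv b)"
  using assms conj_eq_inv[of a b "a \<otimes> b"] conj_eq_inv[of b a "b \<otimes> a"]
  by (simp add: sb3_relations_def m_assoc)

text \<open>Each relation involving \<open>s\<close> or \<open>t\<close> says that one of
  \<open>a\<close>, \<open>b\<close>, \<open>a \<otimes> b\<close>, \<open>b \<otimes> a\<close>
  conjugates one of them to itself or to the other. Conjugation is multiplicative, so such pairs are
  closed under componentwise products.\<close>

lemma sb3_relations_mult: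
  assumes carr: "a \<in> carrier G" "b \<in> carrier G" "s \<in> carrier G" "t \<in> carrier G"
      "c \<in> carrier G" "d \<in> carrier G"
    and st: "sb3_relations G a b s t" and cd: "sb3_relations G a b c d"
  shows "sb3_relations G a b (s \<otimes> c) (t \<otimes> d)"
proof -
  have swap: "g \<otimes> (x \<otimes> x') = y \<otimes> y' \<otimes> g"
    if "g \<otimes> x = y \<otimes> g" "g \<otimes> x' = y' \<otimes> g"
      "g \<in> carrier G" "x \<in> carrier G" "x' \<in> carrier G" "y \<in> carrier G" "y' \<in> carrier G"
    for g x x' y y'
    using that by (metis m_assoc)
  show ?thesis
    using st cd carr swap[of a s s c c] swap[of b t t d d]
      swap[of "a \<otimes> b" s t c d] swap[of "b \<otimes> a" t s d c]
    by (simp add: sb3_relations_def m_assoc)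
qed

end

lemma group_SB3: "group SB3"
  by (simp add: SB3_def group_presented_group)

lemma sb3_closed: "sb3 x \<in> carrier SB3"
  by (simp add: SB3_def sb3_def pres_gen_def carrier_presented_group)

lemma sb3_relations_SB3:
  "sb3_relations SB3 (sb3 Sigma1) (sb3 Sigma2) (sb3 Tau1) (sb3 Tau2)"
proof -
  have "pres_class SB3_rels l = pres_class SB3_rels r" if "(l, r) \<in> SB3_rels" for l r
    using pres_eq.rel[OF that, of "[]" "[]"] by (simp add: pres_class_eq_iff)
  then show ?thesis
    by (simp add: sb3_relations_def SB3_def sb3_def pres_gen_def mult_presented_group SB3_rels_def)
qed

lemma SB3_hom_exists:
  assumes "group G"
    and carr: "a \<in> carrier G" "b \<in> carrier G" "s \<in> carrier G" "t \<in> carrier G"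
    and rels: "sb3_relations G a b s t"
  obtains h where "h \<in> hom SB3 G" "h (sb3 Sigma1) = a" "h (sb3 Sigma2) = b"
    "h (sb3 Tau1) = s" "h (sb3 Tau2) = t"
proof -
  interpret group G by fact
  define f where "f = case_sb3_gen a b s t"
  have "f x \<in> carrier G" for x
    using carr by (cases x) (simp_all add: f_def)
  moreover have "word_eval G f l = word_eval G f r" if "(l, r) \<in> SB3_rels" for l r
    using that rels carr
    by (auto simp: SB3_rels_def word_eval_def letter_eval_def f_def sb3_relations_def)
  ultimately obtain h where "h \<in> hom SB3 G" "\<And>x. h (sb3 x) = f x"
    using presented_group_universal[OF assms(1), of f SB3_rels]
    by (auto simp: SB3_def sb3_def)
  then show thesis by (intro that[of h]) (simp_all add: f_def)
qed

lemma SB3_hom_eqI: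
  assumes "group G" "h \<in> hom SB3 G" "k \<in> hom SB3 G" "x \<in> carrier SB3"
    and "h (sb3 Sigma1) = k (sb3 Sigma1)" "h (sb3 Sigma2) = k (sb3 Sigma2)"
    and "h (sb3 Tau1) = k (sb3 Tau1)" "h (sb3 Tau2) = k (sb3 Tau2)"
  shows "h x = k x"
proof -
  have "h (sb3 g) = k (sb3 g)" for g
    using assms by (cases g) simp_all
  then show ?thesis
    using assms presented_group_hom_unique[of G h SB3_rels k x] by (simp add: SB3_def sb3_def)
qed

text \<open>A kernel is the fibre over the unit of \<open>H\<close>, so a bijection carrying
  \<open>\<pi>\<close> to \<open>\<rho>\<close> matches the two kernels; being multiplicative, it
  restricts to an isomorphism.\<close>

lemma kernels_iso:
  assumes \<phi>: "\<phi> \<in> hom G G'" and \<psi>: "\<psi> \<in> hom G' G"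
    and \<psi>\<phi>: "\<And>x. x \<in> carrier G \<Longrightarrow> \<psi> (\<phi> x) = x"
    and \<phi>\<psi>: "\<And>y. y \<in> carrier G' \<Longrightarrow> \<phi> (\<psi> y) = y"
    and \<rho>\<phi>: "\<And>x. x \<in> carrier G \<Longrightarrow> \<rho> (\<phi> x) = \<pi> x"
  shows "G \<lparr> carrier := kernel G H \<pi> \<rparr> \<cong> G' \<lparr> carrier := kernel G' H \<rho> \<rparr>"
proof -
  have "\<pi> (\<psi> y) = \<rho> y" if "y \<in> carrier G'" for y
    using that \<rho>\<phi>[of "\<psi> y"] \<phi>\<psi> hom_in_carrier[OF \<psi>] by simp
  then have "bij_betw \<phi> (kernel G H \<pi>) (kernel G' H \<rho>)"
    using hom_in_carrier[OF \<phi>] hom_in_carrier[OF \<psi>] \<psi>\<phi> \<phi>\<psi> \<rho>\<phi>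
    by (intro bij_betwI[where g = \<psi>]) (auto simp: kernel_def)
  moreover from this
  have "\<phi> \<in> hom (G \<lparr> carrier := kernel G H \<pi> \<rparr>) (G' \<lparr> carrier := kernel G' H \<rho> \<rparr>)"
    using \<phi> by (auto simp: hom_def kernel_def bij_betw_def)
  ultimately show ?thesis by (auto simp: is_iso_def iso_def)
qed

theorem theorem1p1:
  fixes \<pi> \<rho> :: "sb3_gen gword set \<Rightarrow> nat \<Rightarrow> nat"
  assumes "\<pi> \<in> hom SB3 (sym_group 3)"
    and "\<pi> (sb3 Sigma1) = transpose 1 2"
    and "\<pi> (sb3 Sigma2) = transpose 2 3"
    and "\<pi> (sb3 Tau1) = \<one>\<^bsub>sym_group 3\<^esub>"
    and "\<pi> (sb3 Tau2) = \<one>\<^bsub>sym_group 3\<^esub>"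
    and "\<rho> \<in> hom SB3 (sym_group 3)"
    and "\<rho> (sb3 Sigma1) = transpose 1 2"
    and "\<rho> (sb3 Sigma2) = transpose 2 3"
    and "\<rho> (sb3 Tau1) = transpose 1 2"
    and "\<rho> (sb3 Tau2) = transpose 2 3"
  shows "SB3 \<lparr> carrier := kernel SB3 (sym_group 3) \<pi> \<rparr> \<cong>
    SB3 \<lparr> carrier := kernel SB3 (sym_group 3) \<rho> \<rparr>"
proof -
  interpret SB: group SB3 by (rule group_SB3)
  note SB3_rel = sb3_relations_SB3 [unfolded sb3_relations_def]
  let ?a = "sb3 Sigma1" and ?b = "sb3 Sigma2" and ?s = "sb3 Tau1" and ?t = "sb3 Tau2"
  \<comment> \<open>With each \<tau> replaced by the matching \<sigma>, the commutation relations
    become trivial and the last two become the braid relation, read in either direction.\<close>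
  have "sb3_relations SB3 ?a ?b ?a ?b"
    using SB3_rel by (simp add: sb3_relations_def)
  then have "sb3_relations SB3 ?a ?b (?s \<otimes>\<^bsub>SB3\<^esub> ?a) (?t \<otimes>\<^bsub>SB3\<^esub> ?b)"
    by (intro SB.sb3_relations_mult sb3_relations_SB3 sb3_closed)
  then obtain \<phi> where \<phi>: "\<phi> \<in> hom SB3 SB3" "\<phi> ?a = ?a" "\<phi> ?b = ?b"
      "\<phi> ?s = ?s \<otimes>\<^bsub>SB3\<^esub> ?a" "\<phi> ?t = ?t \<otimes>\<^bsub>SB3\<^esub> ?b"
    by (rule SB3_hom_exists[OF group_SB3, rotated 4]) (simp_all add: sb3_closed)
  have "sb3_relations SB3 ?a ?b (inv\<^bsub>SB3\<^esub> ?a) (inv\<^bsub>SB3\<^esub> ?b)"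
    using SB3_rel by (intro SB.sb3_relations_inv sb3_closed) simp
  then have "sb3_relations SB3 ?a ?b (?s \<otimes>\<^bsub>SB3\<^esub> inv\<^bsub>SB3\<^esub> ?a) (?t \<otimes>\<^bsub>SB3\<^esub> inv\<^bsub>SB3\<^esub> ?b)"
    by (intro SB.sb3_relations_mult sb3_relations_SB3 SB.inv_closed sb3_closed)
  then obtain \<psi> where \<psi>: "\<psi> \<in> hom SB3 SB3" "\<psi> ?a = ?a" "\<psi> ?b = ?b"
      "\<psi> ?s = ?s \<otimes>\<^bsub>SB3\<^esub> inv\<^bsub>SB3\<^esub> ?a" "\<psi> ?t = ?t \<otimes>\<^bsub>SB3\<^esub> inv\<^bsub>SB3\<^esub> ?b"
    by (rule SB3_hom_exists[OF group_SB3, rotated 4]) (simp_all add: sb3_closed)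
  interpret \<phi>: group_hom SB3 SB3 \<phi>
    using \<phi>(1) by unfold_locales
  interpret \<psi>: group_hom SB3 SB3 \<psi>
    using \<psi>(1) by unfold_locales
  have id_hom: "(\<lambda>x. x) \<in> hom SB3 SB3"
    by (simp add: hom_def)
  show ?thesis
  proof (rule kernels_iso[OF \<phi>(1) \<psi>(1)])
    fix x assume x: "x \<in> carrier SB3"
    \<comment> \<open>It suffices to compare on generators: each \<sigma> is fixed, and
      \<open>\<tau>\<^sub>i\<close> goes to \<open>\<tau>\<^sub>i \<sigma>\<^sub>i\<close> and then
      to \<open>\<tau>\<^sub>i \<sigma>\<^sub>i\<^sup>-\<^sup>1 \<sigma>\<^sub>i\<close>.\<close>
    show "\<psi> (\<phi> x) = x"
      using SB3_hom_eqI[OF group_SB3 hom_compose[OF \<phi>(1) \<psi>(1)] id_hom x] \<phi> \<psi>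
      by (simp add: sb3_closed SB.m_assoc)
    show "\<phi> (\<psi> x) = x"
      using SB3_hom_eqI[OF group_SB3 hom_compose[OF \<psi>(1) \<phi>(1)] id_hom x] \<phi> \<psi>
      by (simp add: sb3_closed SB.m_assoc)
    \<comment> \<open>On \<open>\<tau>\<^sub>i\<close> the left side is the square of a
      transposition, hence the identity; on each \<sigma> both sides are the same
      transposition.\<close>
    show "\<rho> (\<phi> x) = \<pi> x"
      using SB3_hom_eqI[OF sym_group_is_group hom_compose[OF \<phi>(1) assms(6)] assms(1) x] \<phi> assms
      by (simp add: sb3_closed hom_mult sym_group_mult sym_group_one)
  qed
qed

end
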